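(* Let $G$ be a Polish group and let $m$ be a continuous transitive partial action of $G$ on a Hausdorff space $X$ which is not meager (in itself). Suppose that $G^y$ is open in $G$ for some $y\in X$. Then for every $x\in X$ the map $m^x\colon G^x\to X$, $g\mapsto g\cdot x$, is open.
   Context: A partial action of a group $G$ (identity $1$) on a set $X$ is a partially defined function $m\colon G\times X\to X$, $(g,x)\mapsto g\cdot x$, such that, writing $\exists\, g\cdot x$ for "$(g,x)$ is in the domain of $m$", for all $g,h\in G$ and $x\in X$: (PA1) $\exists\, g\cdot x$ implies $\exists\, g^{-1}\cdot(g\cdot x)$ and $g^{-1}\cdot(g\cdot x)=x$; (PA2) $\exists\, g\cdot(h\cdot x)$ implies $\exists\,(gh)\cdot x$ and $g\cdot(h\cdot x)=(gh)\cdot x$; (PA3) $\exists\, 1\cdot x$ and $1\cdot x=x$. Notation: $G*X=\{(g,x)\in G\times X: \exists\, g\cdot x\}$ is the domain of $m$; $X_{g^{-1}}=\{x\in X:\exists\, g\cdot x\}$; $m_g\colon X_{g^{-1}}\to X_g$, $x\mapsto g\cdot x$ (a bijection); $G^x=\{g\in G:\exists\, g\cdot x\}$, with the subspace topology from $G$. When $G$ is a topological group and $X$ a topological space, $m$ is a continuous partial action if each $X_g$ is open in $X$, each $m_g\colon X_{g^{-1}}\to X_g$ is a homeomorphism, and $m\colon G*X\to X$ is continuous, where $G*X$ has the topology induced from the product $G\times X$. $m$ is transitive if for all $x,y\in X$ there is $g\in G$ with $x\in X_{g^{-1}}$ and $g\cdot x=y$. A Polish group is a topological group whose topology is separable and completely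 metrizable. *)

theory Defs
  imports "HOL-Analysis.Analysis" "HOL-Algebra.Group"
begin

locale topological_group = group G for G :: "('g, 'r) monoid_scheme" (structure) +
  fixes T :: "'g topology"
  assumes topspace_eq: "topspace T = carrier G"
    and continuous_mult: "continuous_map (prod_topology T T) T (\<lambda>(g, h). g \<otimes> h)"
    and continuous_inv: "continuous_map T T (\<lambda>g. inv g)"

definition separable_space :: "'a topology \<Rightarrow> bool" where
  "separable_space X \<longleftrightarrow> (\<exists>C. countable C \<and> C \<subseteq> topspace X \<and> X closure_of C = topspace X)"

locale polish_group = topological_group +
  assumes separable: "separable_space T"
    and completely_metrizable: "completely_metrizable_space T"

definition nowhere_dense_in :: "'a topology \<Rightarrow> 'a set \<Rightarrow> bool" where
  "nowhere_dense_in X N \<longleftrightarrow> N \<subseteq> topspace X \<and> X interior_of (X closure_of N) = {}"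

definition meager_in :: "'a topology \<Rightarrow> 'a set \<Rightarrow> bool" where
  "meager_in X S \<longleftrightarrow>
     (\<exists>\<N>. countable \<N> \<and> (\<forall>N\<in>\<N>. nowhere_dense_in X N) \<and> S = \<Union>\<N>)"

text \<open>A partially defined function from \<open>G \<times> X\<close> to \<open>X\<close> is a map \<open>m\<close> on pairs, with
  \<open>m (g, x) = Some y\<close> meaning that \<open>g \<cdot> x\<close> exists and equals \<open>y\<close>; its domain
  \<open>G * X\<close> is \<open>dom m\<close>.\<close>

locale partial_action = group G for G :: "('g, 'r) monoid_scheme" (structure) +
  fixes X :: "'x set" and m :: "'g \<times> 'x \<rightharpoonup> 'x"
  assumes dom_subset: "dom m \<subseteq> carrier G \<times> X"
    and ran_subset: "ran m \<subseteq> X"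
    and PA1: "\<lbrakk>g \<in> carrier G; x \<in> X; m (g, x) = Some y\<rbrakk> \<Longrightarrow> m (inv g, y) = Some x"
    and PA2: "\<lbrakk>g \<in> carrier G; h \<in> carrier G; x \<in> X; m (h, x) = Some y; m (g, y) = Some z\<rbrakk>
               \<Longrightarrow> m (g \<otimes> h, x) = Some z"
    and PA3: "x \<in> X \<Longrightarrow> m (\<one>, x) = Some x"

text \<open>\<open>pa_set G m g\<close> is \<open>X\<^sub>g\<close>, the set of \<open>x\<close> such that \<open>g\<^sup>-\<^sup>1 \<cdot> x\<close> exists,
  and \<open>pa_elems m x\<close> is \<open>G\<^sup>x\<close>. The values of \<open>pa_app\<close> matter only on \<open>dom m\<close>.\<close>

definition pa_set :: "('g, 'r) monoid_scheme \<Rightarrow> ('g \<times> 'x \<rightharpoonup> 'x) \<Rightarrow> 'g \<Rightarrow> 'x set" where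
  "pa_set G m g = {x. (inv\<^bsub>G\<^esub> g, x) \<in> dom m}"

definition pa_elems :: "('g \<times> 'x \<rightharpoonup> 'x) \<Rightarrow> 'x \<Rightarrow> 'g set" where
  "pa_elems m x = {g. (g, x) \<in> dom m}"

definition pa_app :: "('g \<times> 'x \<rightharpoonup> 'x) \<Rightarrow> 'g \<Rightarrow> 'x \<Rightarrow> 'x" where
  "pa_app m g x = the (m (g, x))"

lemma (in partial_action) pa_set_inv:
  "g \<in> carrier G \<Longrightarrow> pa_set G m (inv g) = {x. (g, x) \<in> dom m}"
  by (simp add: pa_set_def)

locale continuous_partial_action =
  topological_group G T + partial_action G "topspace X" m
  for G :: "('g, 'r) monoid_scheme" (structure) and T :: "'g topology"
    and X :: "'x topology" and m :: "'g \<times> 'x \<rightharpoonup> 'x" +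
  assumes openin_pa_set: "g \<in> carrier G \<Longrightarrow> openin X (pa_set G m g)"
    and homeomorphic: "g \<in> carrier G \<Longrightarrow>
      homeomorphic_map (subtopology X (pa_set G m (inv g))) (subtopology X (pa_set G m g)) (pa_app m g)"
    and continuous_action:
      "continuous_map (subtopology (prod_topology T X) (dom m)) X (\<lambda>(g, x). pa_app m g x)"

definition transitive_partial_action ::
  "('g, 'r) monoid_scheme \<Rightarrow> 'x set \<Rightarrow> ('g \<times> 'x \<rightharpoonup> 'x) \<Rightarrow> bool" where
  "transitive_partial_action G X m \<longleftrightarrow>
     (\<forall>x\<in>X. \<forall>y\<in>X. \<exists>g\<in>carrier G. x \<in> pa_set G m (inv\<^bsub>G\<^esub> g) \<and> pa_app m g x = y)"

end

theory Submission
  imports Defs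
begin

text \<open>Since \<open>G\<^sup>x\<close> is a right translate of \<open>G\<^sup>y\<close>, all orbit maps have open, hence
  completely metrizable, domain. As \<open>G\<close> is separable, \<open>X\<close> is covered by countably many
  partial translates of the image of any nonempty open set, and as \<open>X\<close> is nonmeager the orbit map
  is nearly open: each image \<open>m\<^sup>x(U)\<close> lies in the interior of its closure. If the
  interiors of the closures of \<open>m\<^sup>x(U)\<close> and \<open>m\<^sup>x(V)\<close> meet, a back-and-forth construction
  with complete nested sets shows that \<open>m\<^sup>x(U)\<close> and \<open>m\<^sup>x(V)\<close> meet already. Applied to
  \<open>N a\<close> and \<open>N q\<close> for a small neighbourhood \<open>N\<close> of the identity, this puts each point
  \<open>q \<cdot> x\<close> of the interior of the closure of \<open>m\<^sup>x(N a)\<close> into \<open>m\<^sup>x(N\<^sup>-\<^sup>1 N a)\<close>.\<close>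

section \<open>Interiors of closures and nearly open maps\<close>

definition closure_interior :: "'a topology \<Rightarrow> 'a set \<Rightarrow> 'a set" where
  "closure_interior X A = X interior_of (X closure_of A)"

lemma openin_closure_interior [simp]: "openin X (closure_interior X A)"
  by (simp add: closure_interior_def)

lemma closure_interior_meets:
  assumes "z \<in> closure_interior X A" "openin X Q" "z \<in> Q"
  obtains a where "a \<in> A" "a \<in> Q"
proof -
  have "z \<in> X closure_of A"
    using assms(1) interior_of_subset unfolding closure_interior_def by fast
  then show thesis
    using assms that unfolding in_closure_of by blast
qed

lemma closure_interiorI:
  assumes "openin X Q" "z \<in> Q" and meets: "\<And>y P. y \<in> Q \<Longrightarrow> openin X P \<Longrightarrow> y \<in> P \<Longrightarrow> A \<inter> P \<noteq> {}"
  shows "z \<in> closure_interior X A"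
proof -
  have "Q \<subseteq> X closure_of A"
    using meets openin_subset[OF assms(1)] unfolding in_closure_of subset_iff by blast
  then show ?thesis
    using interior_of_maximal[OF _ assms(1)] assms(2) unfolding closure_interior_def by blast
qed

text \<open>A category argument yields only this weak form of openness; completeness and the group
  structure have to supply the rest.\<close>

definition nearly_open_map :: "'a topology \<Rightarrow> 'b topology \<Rightarrow> ('a \<Rightarrow> 'b) \<Rightarrow> bool" where
  "nearly_open_map S X f \<longleftrightarrow> (\<forall>U. openin S U \<longrightarrow> f ` U \<subseteq> closure_interior X (f ` U))"

lemma nearly_open_mapD:
  "nearly_open_map S X f \<Longrightarrow> openin S U \<Longrightarrow> p \<in> U \<Longrightarrow> f p \<in> closure_interior X (f ` U)"
  by (auto simp: nearly_open_map_def)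

text \<open>The invariant of the back-and-forth construction: under a nearly open map, either set
  can be shrunk around a suitable point without losing it.\<close>

definition nearly_meet :: "'b topology \<Rightarrow> 'b set \<Rightarrow> 'b set \<Rightarrow> bool" where
  "nearly_meet X A B \<longleftrightarrow> closure_interior X A \<inter> closure_interior X B \<noteq> {}"

lemma nearly_meet_commute: "nearly_meet X A B \<longleftrightarrow> nearly_meet X B A"
  by (auto simp: nearly_meet_def)

lemma nearly_meet_obtains:
  assumes "nearly_meet X A B"
  obtains a where "a \<in> A" "a \<in> closure_interior X B"
proof -
  obtain z where z: "z \<in> closure_interior X A" "z \<in> closure_interior X B"
    using assms by (auto simp: nearly_meet_def)
  show thesis
    using closure_interior_meets[OF z(1) openin_closure_interior z(2)] that by metis
qed

lemma nearly_meet_imp_nonempty: "nearly_meet X A B \<Longrightarrow> A \<noteq> {} \<and> B \<noteq> {}"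
  by (metis empty_iff nearly_meet_commute nearly_meet_obtains)

text \<open>Some point of \<open>A\<close>, hence of the open set \<open>P\<close>, lies in the
  closure of \<open>B\<close>, so \<open>P\<close> meets \<open>B\<close>. This rules out a
  separation of the two sets by disjoint neighbourhoods.\<close>

lemma nearly_meet_open_supersets:
  assumes "nearly_meet X A B" and P: "openin X P" "A \<subseteq> P" and Q: "B \<subseteq> Q"
  shows "P \<inter> Q \<noteq> {}"
proof -
  obtain a where "a \<in> A" and a: "a \<in> closure_interior X B"
    using assms(1) by (rule nearly_meet_obtains)
  then have "a \<in> P" using P by blast
  then show ?thesis
    using closure_interior_meets[OF a P(1)] Q by (metis disjoint_iff subsetD)
qed

section \<open>Back-and-forth in a complete metric space\<close>

text \<open>Choose \<open>p\<close> in \<open>U\<close> with \<open>f p\<close> in the interior of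
  the closure of \<open>B\<close>. Near openness puts \<open>f p\<close> also into the interior of
  the closure of the image of any ball around \<open>p\<close>, so \<open>f p\<close> witnesses the
  new overlap. Since \<open>B\<close> stays fixed, the two sides can be treated in turn.\<close>

lemma (in Metric_space) nearly_meet_shrink:
  assumes f: "nearly_open_map mtopology X f" and U: "openin mtopology U"
    and meet: "nearly_meet X (f ` U) B" and "0 < e"
  shows "\<exists>U' p. openin mtopology U' \<and> mtopology closure_of U' \<subseteq> U \<and> U' \<subseteq> mcball p e \<and>
    nearly_meet X (f ` U') B"
proof -
  obtain p where p: "p \<in> U" "f p \<in> closure_interior X B"
    using nearly_meet_obtains[OF meet] by blast
  obtain r where r: "r > 0" "mcball p r \<subseteq> U"
    using U p(1) unfolding openin_mtopology_mcball by blast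
  \<comment> \<open>The bound \<open>r\<close> keeps the closure inside \<open>U\<close>, the bound
    \<open>e\<close> controls the size.\<close>
  define U' where "U' = mball p (min r e)"
  have "p \<in> M"
    using U p(1) openin_subset by fastforce
  then have pU': "p \<in> U'"
    using r \<open>0 < e\<close> by (simp add: U'_def)
  have op: "openin mtopology U'"
    by (simp add: U'_def)
  have sub: "U' \<subseteq> mcball p r" "U' \<subseteq> mcball p e"
    by (auto simp: U'_def)
  have "mtopology closure_of U' \<subseteq> U"
    using closure_of_minimal[OF sub(1)] r(2) by blast
  moreover have "f p \<in> closure_interior X (f ` U')"
    using f op pU' by (rule nearly_open_mapD)
  then have "nearly_meet X (f ` U') B"
    using p(2) by (auto simp: nearly_meet_def)
  ultimately show ?thesis
    using op sub by blast
qed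

text \<open>Cantor's intersection theorem for the closures gives the point. Each closure lies in the
  preceding open set, so the point lies in all of them, and vanishing radii force the sets into
  every neighbourhood of it.\<close>

lemma (in Metric_space) nested_open_limit:
  fixes U :: "nat \<Rightarrow> 'a set"
  assumes mcomplete and op: "\<And>n. openin mtopology (U n)" and ne: "\<And>n. U n \<noteq> {}"
    and cl: "\<And>n. mtopology closure_of (U (Suc n)) \<subseteq> U n"
    and small: "\<And>n. \<exists>p. U (Suc n) \<subseteq> mcball p (inverse (Suc n))"
  obtains p where "\<And>n. p \<in> U n"
    and "\<And>W. openin mtopology W \<Longrightarrow> p \<in> W \<Longrightarrow> \<exists>n. \<forall>k\<ge>n. U k \<subseteq> W"
proof -
  have sub: "U (Suc n) \<subseteq> U n" for n
    using cl[of n] closure_of_subset[of "U (Suc n)" mtopology] op[of "Suc n"] openin_subset by blast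
  then have dec: "U k \<subseteq> U n" if "n \<le> k" for n k
    using that by (rule lift_Suc_antimono_le)
  \<comment> \<open>The index is shifted because \<open>small\<close> bounds only successors, and so
    that \<open>cl\<close> gives \<open>C n \<subseteq> U n\<close> from \<open>n = 0\<close>
    on.\<close>
  define C where "C = (\<lambda>n. mtopology closure_of (U (Suc n)))"
  have "decseq C"
    unfolding C_def by (intro decseq_SucI closure_of_mono sub)
  moreover have "C n \<noteq> {}" for n
    using ne[of "Suc n"] closure_of_subset[of "U (Suc n)" mtopology] op[of "Suc n"] openin_subset
    unfolding C_def by blast
  moreover have "\<exists>n a. C n \<subseteq> mcball a e" if e: "e > 0" for e
  proof -
    obtain n where n: "inverse (real (Suc n)) < e"
      using e reals_Archimedean by blast
    obtain a where "U (Suc n) \<subseteq> mcball a (inverse (Suc n))"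
      using small by blast
    then have "C n \<subseteq> mcball a (inverse (Suc n))"
      unfolding C_def by (intro closure_of_minimal) auto
    also have "\<dots> \<subseteq> mcball a e"
      using n by (intro mcball_subset_concentric) simp
    finally show ?thesis by blast
  qed
  moreover have "closedin mtopology (C n)" for n
    by (simp add: C_def)
  ultimately have "\<Inter> (range C) \<noteq> {}"
    using \<open>mcomplete\<close> unfolding mcomplete_nest by blast
  then obtain p where "\<And>n. p \<in> C n"
    by blast
  then have p: "p \<in> U n" for n
    using cl unfolding C_def by blast
  have "\<exists>n. \<forall>k\<ge>n. U k \<subseteq> W" if W: "openin mtopology W" "p \<in> W" for W
  proof -
    obtain r where r: "r > 0" "mball p r \<subseteq> W"
      using W unfolding openin_mtopology by blast
    \<comment> \<open>Two points of one closed ball of radius below \<open>r / 2\<close> have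
      distance below \<open>r\<close>.\<close>
    obtain n where n: "inverse (real (Suc n)) < r / 2"
      using r reals_Archimedean half_gt_zero by blast
    obtain a where a: "U (Suc n) \<subseteq> mcball a (inverse (Suc n))"
      using small by blast
    have "U (Suc n) \<subseteq> mball p r"
    proof
      fix u assume "u \<in> U (Suc n)"
      then have "u \<in> mcball a (inverse (Suc n))" "p \<in> mcball a (inverse (Suc n))"
        using a p by blast+
      then show "u \<in> mball p r"
        using n triangle'[of p a u] by (auto simp: commute)
    qed
    then show ?thesis
      using dec r by blast
  qed
  with p that show thesis by blast
qed

text \<open>The substitute for the Baire property of analytic sets in the usual proofs of Effros' theorem:
  both sets are shrunk alternately, and the images of the two limit points cannot be separated.\<close>

lemma nearly_meet_imp_meet:
  assumes S: "completely_metrizable_space S" and X: "Hausdorff_space X"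
    and cont: "continuous_map S X f" and f: "nearly_open_map S X f"
    and U: "openin S U" and V: "openin S V" and meet: "nearly_meet X (f ` U) (f ` V)"
  shows "f ` U \<inter> f ` V \<noteq> {}"
proof -
  obtain M d where "Metric_space M d" and c: "Metric_space.mcomplete M d"
    and S_eq: "S = Metric_space.mtopology M d"
    using S unfolding completely_metrizable_space_def by blast
  then interpret Metric_space M d
    by simp
  define good where "good = (\<lambda>(U, V). openin S U \<and> openin S V \<and> nearly_meet X (f ` U) (f ` V))"
  define shrinks where "shrinks = (\<lambda>n U U'. S closure_of U' \<subseteq> U \<and>
    (\<exists>p. U' \<subseteq> mcball p (inverse (real (Suc n)))))"
  \<comment> \<open>The clause for \<open>n = 0\<close> pins the start of the sequence, which later
    places the limit points in \<open>U\<close> and \<open>V\<close>.\<close>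
  have "\<exists>w. \<forall>n. (good (w n) \<and> (n = 0 \<longrightarrow> w n = (U, V))) \<and>
    (shrinks n (fst (w n)) (fst (w (Suc n))) \<and> shrinks n (snd (w n)) (snd (w (Suc n))))"
  proof (rule dependent_nat_choice)
    show "\<exists>x. good x \<and> (0 = (0::nat) \<longrightarrow> x = (U, V))"
      using U V meet by (auto simp: good_def)
  next
    fix x and n :: nat assume "good x \<and> (n = 0 \<longrightarrow> x = (U, V))"
    then obtain A B where x: "x = (A, B)" and AB: "openin S A" "openin S B" "nearly_meet X (f ` A) (f ` B)"
      by (cases x) (auto simp: good_def)
    have e: "0 < inverse (real (Suc n))"
      by simp
    obtain A' where A': "openin S A'" "shrinks n A A'" "nearly_meet X (f ` A') (f ` B)"
      using nearly_meet_shrink[OF f[unfolded S_eq] AB(1)[unfolded S_eq] AB(3) e]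
      unfolding shrinks_def S_eq by blast
    \<comment> \<open>The second side is shrunk against the already shrunken \<open>A'\<close>, so
      that the new pair still nearly meets.\<close>
    obtain B' where "openin S B'" "shrinks n B B'" "nearly_meet X (f ` B') (f ` A')"
      using nearly_meet_shrink[OF f[unfolded S_eq] AB(2)[unfolded S_eq]
          A'(3)[unfolded nearly_meet_commute[of X "f ` A'"]] e]
      unfolding shrinks_def S_eq by blast
    with A' have "good (A', B')" "shrinks n A A'" "shrinks n B B'"
      by (auto simp: good_def nearly_meet_commute)
    then show "\<exists>y. (good y \<and> (Suc n = 0 \<longrightarrow> y = (U, V))) \<and>
      (shrinks n (fst x) (fst y) \<and> shrinks n (snd x) (snd y))"
      unfolding x by (intro exI[of _ "(A', B')"]) simp
  qed
  then obtain w where w: "\<And>n. good (w n)" "w 0 = (U, V)"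
    "\<And>n. shrinks n (fst (w n)) (fst (w (Suc n)))" "\<And>n. shrinks n (snd (w n)) (snd (w (Suc n)))"
    by blast
  have good: "openin S (fst (w n))" "openin S (snd (w n))"
    "nearly_meet X (f ` fst (w n)) (f ` snd (w n))" for n
    using w(1)[of n] by (auto simp: good_def split: prod.splits)
  have ne: "fst (w n) \<noteq> {}" "snd (w n) \<noteq> {}" for n
    using good(3)[of n] nearly_meet_imp_nonempty by blast+
  obtain p where p: "\<And>n. p \<in> fst (w n)"
    "\<And>W. openin S W \<Longrightarrow> p \<in> W \<Longrightarrow> \<exists>n. \<forall>k\<ge>n. fst (w k) \<subseteq> W"
  proof (rule nested_open_limit[of "\<lambda>n. fst (w n)", OF c])
    show "openin mtopology (fst (w n))" "fst (w n) \<noteq> {}" "mtopology closure_of fst (w (Suc n)) \<subseteq> fst (w n)"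
      "\<exists>p. fst (w (Suc n)) \<subseteq> mcball p (inverse (real (Suc n)))" for n
      using good(1) ne(1) w(3) by (simp_all add: shrinks_def S_eq)
  qed (rule that; simp add: S_eq)
  obtain q where q: "\<And>n. q \<in> snd (w n)"
    "\<And>W. openin S W \<Longrightarrow> q \<in> W \<Longrightarrow> \<exists>n. \<forall>k\<ge>n. snd (w k) \<subseteq> W"
  proof (rule nested_open_limit[of "\<lambda>n. snd (w n)", OF c])
    show "openin mtopology (snd (w n))" "snd (w n) \<noteq> {}" "mtopology closure_of snd (w (Suc n)) \<subseteq> snd (w n)"
      "\<exists>p. snd (w (Suc n)) \<subseteq> mcball p (inverse (real (Suc n)))" for n
      using good(2) ne(2) w(4) by (simp_all add: shrinks_def S_eq)
  qed (rule that; simp add: S_eq)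
  have pS: "p \<in> topspace S" "q \<in> topspace S"
    using p(1) q(1) good openin_subset by blast+
  have "f p = f q"
  proof (rule ccontr)
    assume "f p \<noteq> f q"
    moreover have "f p \<in> topspace X" "f q \<in> topspace X"
      using pS cont continuous_map_image_subset_topspace by blast+
    ultimately obtain P Q where PQ: "openin X P" "openin X Q" "f p \<in> P" "f q \<in> Q" "disjnt P Q"
      using X unfolding Hausdorff_space_def by metis
    \<comment> \<open>Continuity pulls the separation back to neighbourhoods of \<open>p\<close> and
      \<open>q\<close>. They swallow the late members of the two sequences, whose images nearly
      meet.\<close>
    define P' Q' where "P' = {x \<in> topspace S. f x \<in> P}" and "Q' = {x \<in> topspace S. f x \<in> Q}"
    have "openin S P'" "openin S Q'"
      unfolding P'_def Q'_def using PQ cont openin_continuous_map_preimage by blast+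
    moreover have "p \<in> P'" "q \<in> Q'"
      using pS PQ by (auto simp: P'_def Q'_def)
    ultimately obtain n n' where n: "\<forall>k\<ge>n. fst (w k) \<subseteq> P'" "\<forall>k\<ge>n'. snd (w k) \<subseteq> Q'"
      using p(2) q(2) by metis
    then have "fst (w (max n n')) \<subseteq> P'" "snd (w (max n n')) \<subseteq> Q'"
      by simp_all
    then have "f ` fst (w (max n n')) \<subseteq> P" "f ` snd (w (max n n')) \<subseteq> Q"
      by (auto simp: P'_def Q'_def)
    then have "P \<inter> Q \<noteq> {}"
      using nearly_meet_open_supersets[OF good(3) PQ(1)] by blast
    with PQ show False by (simp add: disjnt_def)
  qed
  moreover have "p \<in> U" "q \<in> V"
    using p(1)[of 0] q(1)[of 0] w(2) by auto
  ultimately show ?thesis by (metis IntI empty_iff imageI)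
qed

section \<open>Translates and neighbourhoods in a topological group\<close>

context topological_group
begin

lemma carrier_openin: "openin T U \<Longrightarrow> g \<in> U \<Longrightarrow> g \<in> carrier G"
  using openin_subset topspace_eq by blast

lemma continuous_map_group_mult:
  assumes "continuous_map Z T u" "continuous_map Z T v"
  shows "continuous_map Z T (\<lambda>z. u z \<otimes> v z)"
proof -
  have "continuous_map Z (prod_topology T T) (\<lambda>z. (u z, v z))"
    using assms by (simp add: continuous_map_pairwise o_def)
  from continuous_map_compose[OF this continuous_mult] show ?thesis
    by (simp add: o_def)
qed

lemma continuous_map_group_inv: "continuous_map Z T u \<Longrightarrow> continuous_map Z T (\<lambda>z. inv (u z))"
  using continuous_map_compose[OF _ continuous_inv] by (simp add: o_def)

lemma openin_right_translate:
  assumes "openin T U" "h \<in> carrier G"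
  shows "openin T {g \<in> carrier G. g \<otimes> h \<in> U}"
proof -
  have "continuous_map T T (\<lambda>g. g \<otimes> h)"
    using assms by (intro continuous_map_group_mult) (auto simp: topspace_eq)
  from openin_continuous_map_preimage[OF this assms(1)] show ?thesis
    by (simp add: topspace_eq)
qed

text \<open>Continuity at the diagonal point gives a product neighbourhood, and intersecting its
  factors yields one set for both arguments. It is applied to
  \<open>a \<otimes> inv p \<otimes> q\<close> at \<open>a\<close> and to
  \<open>inv p \<otimes> q \<otimes> a\<close> at the identity, both with value
  \<open>a\<close>.\<close>

lemma openin_diagonal_square:
  assumes cont: "continuous_map (prod_topology T T) T f" and U: "openin T U"
    and b: "b \<in> carrier G" "f (b, b) \<in> U"
  obtains B where "openin T B" "b \<in> B" "\<And>p q. p \<in> B \<Longrightarrow> q \<in> B \<Longrightarrow> f (p, q) \<in> U"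
proof -
  let ?P = "{z \<in> topspace (prod_topology T T). f z \<in> U}"
  have "openin (prod_topology T T) ?P"
    using cont U by (rule openin_continuous_map_preimage)
  moreover have "(b, b) \<in> ?P"
    using b by (simp add: topspace_eq)
  ultimately obtain B1 B2 where B: "openin T B1" "openin T B2" "b \<in> B1" "b \<in> B2" "B1 \<times> B2 \<subseteq> ?P"
    unfolding openin_prod_topology_alt by meson
  show thesis
  proof (rule that)
    show "openin T (B1 \<inter> B2)" "b \<in> B1 \<inter> B2"
      using B by auto
    show "f (p, q) \<in> U" if "p \<in> B1 \<inter> B2" "q \<in> B1 \<inter> B2" for p q
      using that B(5) by blast
  qed
qed

text \<open>The \<open>c\<close> with \<open>inv c \<otimes> g \<in> B\<close> form an open set that
  contains \<open>g \<otimes> inv b\<close>, so a dense set hits it. Hence the left translates of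
  \<open>B\<close> by members of \<open>C\<close> cover the group.\<close>

lemma dense_translates_cover:
  assumes C: "C \<subseteq> topspace T" "T closure_of C = topspace T"
    and B: "openin T B" "b \<in> B" and g: "g \<in> carrier G"
  obtains c where "c \<in> C" "inv c \<otimes> g \<in> B"
proof -
  have b: "b \<in> carrier G"
    using B by (rule carrier_openin)
  have "continuous_map T T (\<lambda>c. inv c \<otimes> g)"
    using g by (intro continuous_map_group_mult continuous_map_group_inv) (auto simp: topspace_eq)
  then have "openin T {c \<in> topspace T. inv c \<otimes> g \<in> B}"
    using B(1) by (rule openin_continuous_map_preimage)
  moreover have "inv (g \<otimes> inv b) \<otimes> g = b"
    using b g by (simp add: inv_mult_group m_assoc)
  then have "g \<otimes> inv b \<in> {c \<in> topspace T. inv c \<otimes> g \<in> B}"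
    using b g B by (simp add: topspace_eq)
  moreover have "g \<otimes> inv b \<in> T closure_of C"
    using b g C(2) by (simp add: topspace_eq)
  ultimately obtain c where "c \<in> C" "c \<in> {c \<in> topspace T. inv c \<otimes> g \<in> B}"
    unfolding in_closure_of by meson
  then show thesis
    using that by blast
qed

end

section \<open>Algebra of partial actions\<close>

context partial_action
begin

lemma dom_carrier: "(g, x) \<in> dom m \<Longrightarrow> g \<in> carrier G" "(g, x) \<in> dom m \<Longrightarrow> x \<in> X"
  using dom_subset by auto

lemma pa_app_in: "(g, x) \<in> dom m \<Longrightarrow> pa_app m g x \<in> X"
  using ran_subset by (fastforce simp: pa_app_def ran_def)

lemma pa_app_mult:
  assumes "(g, x) \<in> dom m" "(k, pa_app m g x) \<in> dom m"
  shows "(k \<otimes> g, x) \<in> dom m" "pa_app m (k \<otimes> g) x = pa_app m k (pa_app m g x)"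
proof -
  have "m (k \<otimes> g, x) = Some (pa_app m k (pa_app m g x))"
    using assms dom_carrier by (intro PA2[where y = "pa_app m g x"]) (auto simp: pa_app_def)
  then show "(k \<otimes> g, x) \<in> dom m" "pa_app m (k \<otimes> g) x = pa_app m k (pa_app m g x)"
    by (auto simp: pa_app_def)
qed

lemma pa_app_inv:
  assumes "(g, x) \<in> dom m"
  shows "(inv g, pa_app m g x) \<in> dom m" "pa_app m (inv g) (pa_app m g x) = x"
proof -
  have "m (inv g, pa_app m g x) = Some x"
    using assms dom_carrier by (intro PA1) (auto simp: pa_app_def)
  then show "(inv g, pa_app m g x) \<in> dom m" "pa_app m (inv g) (pa_app m g x) = x"
    by (auto simp: pa_app_def)
qed

text \<open>A converse of \<open>PA2\<close> for the case that \<open>g\<close> acts on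
  \<open>x\<close>: write \<open>k\<close> as \<open>(k \<otimes> g) \<otimes> inv g\<close> and let
  \<open>inv g\<close> carry \<open>pa_app m g x\<close> back to \<open>x\<close>.\<close>

lemma pa_app_mult':
  assumes gx: "(g, x) \<in> dom m" and k: "k \<in> carrier G" "(k \<otimes> g, x) \<in> dom m"
  shows "(k, pa_app m g x) \<in> dom m" "pa_app m k (pa_app m g x) = pa_app m (k \<otimes> g) x"
proof -
  have "((k \<otimes> g) \<otimes> inv g, pa_app m g x) \<in> dom m"
    using pa_app_mult(1)[OF pa_app_inv(1)[OF gx]] pa_app_inv(2)[OF gx] k(2) by simp
  then show "(k, pa_app m g x) \<in> dom m"
    using k(1) dom_carrier(1)[OF gx] by (simp add: m_assoc)
  then show "pa_app m k (pa_app m g x) = pa_app m (k \<otimes> g) x"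
    using pa_app_mult(2)[OF gx] by simp
qed

end

section \<open>Orbit maps of continuous partial actions\<close>

context continuous_partial_action
begin

text \<open>As \<open>h\<close> carries \<open>x\<close> to \<open>y\<close>, \<open>g\<close> acts
  on \<open>x\<close> exactly when \<open>g \<otimes> inv h\<close> acts on \<open>y\<close>, so the
  set for \<open>x\<close> is a preimage under right translation.\<close>

lemma openin_pa_elems_transfer:
  assumes y: "openin T (pa_elems m y)" and hx: "(h, x) \<in> dom m" "pa_app m h x = y"
  shows "openin T (pa_elems m x)"
proof -
  note h = dom_carrier(1)[OF hx(1)]
  have "(g \<otimes> inv h, y) \<in> dom m" if "(g, x) \<in> dom m" for g
    using pa_app_mult(1)[OF pa_app_inv(1)[OF hx(1)]] pa_app_inv(2)[OF hx(1)] that hx(2) by simp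
  moreover have "(g, x) \<in> dom m" if "g \<in> carrier G" "(g \<otimes> inv h, y) \<in> dom m" for g
    using pa_app_mult(1)[OF hx(1)] that hx(2) h by (fastforce simp: m_assoc)
  ultimately have "pa_elems m x = {g \<in> carrier G. g \<otimes> inv h \<in> pa_elems m y}"
    using dom_carrier(1) unfolding pa_elems_def by blast
  then show ?thesis
    using openin_right_translate[OF y, of "inv h"] h by simp
qed

lemma continuous_map_orbit:
  assumes "x \<in> topspace X"
  shows "continuous_map (subtopology T (pa_elems m x)) X (\<lambda>g. pa_app m g x)"
proof -
  have "continuous_map (subtopology T (pa_elems m x)) (subtopology (prod_topology T X) (dom m)) (\<lambda>g. (g, x))"
    using assms by (auto simp: continuous_map_in_subtopology continuous_map_pairwise o_def pa_elems_def)
  from continuous_map_compose[OF this continuous_action] show ?thesis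
    by (simp add: o_def)
qed

text \<open>The action of \<open>k\<close> is a homeomorphism between open subsets of
  \<open>X\<close>, so it respects open sets and limit points. Only the points of \<open>A\<close>
  on which \<open>k\<close> acts have to land in \<open>B\<close>.\<close>

lemma closure_interior_translate:
  assumes y: "y \<in> closure_interior X A" "(k, y) \<in> dom m"
    and AB: "\<And>a. a \<in> A \<Longrightarrow> (k, a) \<in> dom m \<Longrightarrow> pa_app m k a \<in> B"
  shows "pa_app m k y \<in> closure_interior X B"
proof -
  have k: "k \<in> carrier G"
    using y(2) by (rule dom_carrier)
  define D where "D = pa_set G m (inv k)"
  have D: "D = {z. (k, z) \<in> dom m}"
    using k by (simp add: D_def pa_set_inv)
  have oD: "openin X D"
    using k by (simp add: D_def openin_pa_set)
  have oE: "openin X (pa_set G m k)"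
    using k by (rule openin_pa_set)
  note hom = homeomorphic[OF k, folded D_def]
  define Q where "Q = pa_app m k ` (closure_interior X A \<inter> D)"
  show ?thesis
  proof (rule closure_interiorI)
    have "openin (subtopology X D) (closure_interior X A \<inter> D)"
      by (simp add: openin_subtopology_Int)
    then have "openin (subtopology X (pa_set G m k)) Q"
      using homeomorphic_imp_open_map[OF hom] unfolding open_map_def Q_def by blast
    then show "openin X Q"
      using oE openin_trans_full by blast
    show "pa_app m k y \<in> Q"
      using y by (auto simp: Q_def D)
  next
    fix z P assume "z \<in> Q" and P: "openin X P" "z \<in> P"
    then obtain u where u: "u \<in> closure_interior X A" "u \<in> D" "z = pa_app m k u"
      by (auto simp: Q_def)
    \<comment> \<open>The preimage of \<open>P\<close> is open in \<open>X\<close> and contains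
      \<open>u\<close>, a limit of \<open>A\<close>; a point of \<open>A\<close> in it is carried
      into \<open>B\<close> and \<open>P\<close>.\<close>
    have "continuous_map (subtopology X D) X (pa_app m k)"
      using homeomorphic_imp_continuous_map[OF hom] continuous_map_in_subtopology by blast
    from openin_continuous_map_preimage[OF this P(1)]
    have "openin X {v \<in> topspace (subtopology X D). pa_app m k v \<in> P}"
      using oD openin_trans_full by blast
    moreover have "u \<in> {v \<in> topspace (subtopology X D). pa_app m k v \<in> P}"
      using u P oD openin_subset by auto
    ultimately obtain a where "a \<in> A" "a \<in> {v \<in> topspace (subtopology X D). pa_app m k v \<in> P}"
      using closure_interior_meets[OF u(1)] by metis
    then show "B \<inter> P \<noteq> {}"
      using AB D by auto
  qed
qed

text \<open>Some translate \<open>c B\<close> of a small neighbourhood \<open>B\<close> of \<open>a\<close> has a somewhere dense image;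
  for \<open>g \<in> c B\<close> with \<open>g \<cdot> x\<close> in the interior of its closure, \<open>a \<otimes> inv g\<close> carries \<open>g \<cdot> x\<close>
  to \<open>a \<cdot> x\<close> and \<open>c B\<close> into \<open>U\<close>.\<close>

lemma nearly_open_orbit_map:
  assumes sep: "separable_space T" and nonmeager: "\<not> meager_in X (topspace X)"
    and surj: "(\<lambda>g. pa_app m g x) ` pa_elems m x = topspace X"
    and W: "openin T (pa_elems m x)"
  shows "nearly_open_map (subtopology T (pa_elems m x)) X (\<lambda>g. pa_app m g x)"
  unfolding nearly_open_map_def
proof (intro allI impI subsetI)
  let ?f = "\<lambda>g. pa_app m g x"
  fix U z assume "openin (subtopology T (pa_elems m x)) U" and z: "z \<in> ?f ` U"
  then have U: "openin T U" "U \<subseteq> pa_elems m x"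
    using W by (simp_all add: openin_open_subtopology)
  obtain a where a: "a \<in> U" "z = ?f a"
    using z by blast
  have aG: "a \<in> carrier G"
    using U(1) a(1) by (rule carrier_openin)
  \<comment> \<open>This chooses \<open>B\<close> with \<open>a B\<^sup>-\<^sup>1 B\<close> inside
    \<open>U\<close>.\<close>
  have "continuous_map (prod_topology T T) T (\<lambda>p. a \<otimes> inv (fst p) \<otimes> snd p)"
    using aG by (intro continuous_map_group_mult continuous_map_group_inv)
      (auto simp: topspace_eq continuous_map_fst continuous_map_snd)
  then obtain B where B: "openin T B" "a \<in> B" "\<And>p q. p \<in> B \<Longrightarrow> q \<in> B \<Longrightarrow> a \<otimes> inv p \<otimes> q \<in> U"
    by (rule openin_diagonal_square[OF _ U(1) aG]) (use a aG in auto)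
  obtain C where C: "countable C" "C \<subseteq> topspace T" "T closure_of C = topspace T"
    using sep unfolding separable_space_def by blast
  \<comment> \<open>The part of the translate \<open>c B\<close> that acts on \<open>x\<close>;
    countably many of these cover \<open>pa_elems m x\<close>.\<close>
  define piece where "piece c = {g \<in> pa_elems m x. inv c \<otimes> g \<in> B}" for c
  have WG: "g \<in> carrier G" if "g \<in> pa_elems m x" for g
    using W that by (rule carrier_openin)
  have "pa_elems m x = (\<Union>c\<in>C. piece c)"
    using dense_translates_cover[OF C(2,3) B(1,2)] WG unfolding piece_def by blast
  then have "topspace X = (\<Union>c\<in>C. ?f ` piece c)"
    using surj by (metis image_UN)
  then have "meager_in X (topspace X)" if "\<forall>c\<in>C. nowhere_dense_in X (?f ` piece c)"
    unfolding meager_in_def using that C(1) by (intro exI[of _ "(\<lambda>c. ?f ` piece c) ` C"]) auto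
  then have "\<exists>c\<in>C. \<not> nowhere_dense_in X (?f ` piece c)"
    using nonmeager by blast
  moreover have "?f ` piece c \<subseteq> topspace X" for c
    using surj by (auto simp: piece_def)
  ultimately obtain c where c: "c \<in> C" "closure_interior X (?f ` piece c) \<noteq> {}"
    unfolding nowhere_dense_in_def closure_interior_def by blast
  then obtain z' where z': "z' \<in> closure_interior X (?f ` piece c)"
    by blast
  obtain g where g: "g \<in> piece c" "?f g \<in> closure_interior X (?f ` piece c)"
    using closure_interior_meets[OF z' openin_closure_interior z'] by blast
  have cG: "c \<in> carrier G"
    using c C topspace_eq by blast
  have gG: "g \<in> carrier G" and gx: "(g, x) \<in> dom m"
    using g WG by (auto simp: piece_def pa_elems_def)
  have ax: "(a \<otimes> inv g \<otimes> g, x) \<in> dom m"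
    using a U aG gG by (auto simp: m_assoc pa_elems_def)
  have "pa_app m (a \<otimes> inv g) (?f g) \<in> closure_interior X (?f ` U)"
  proof (rule closure_interior_translate[OF g(2)])
    show "(a \<otimes> inv g, ?f g) \<in> dom m"
      using pa_app_mult'(1)[OF gx _ ax] aG gG by simp
    fix y assume "y \<in> ?f ` piece c" and y: "(a \<otimes> inv g, y) \<in> dom m"
    then obtain g' where g': "g' \<in> piece c" "y = ?f g'"
      by blast
    then have g'G: "g' \<in> carrier G" and g'x: "(g', x) \<in> dom m"
      using WG by (auto simp: piece_def pa_elems_def)
    \<comment> \<open>Both \<open>g\<close> and \<open>g'\<close> lie in \<open>c B\<close>, and the
      unknown \<open>c\<close> cancels in \<open>inv g \<otimes> g'\<close>.\<close>
    have "a \<otimes> inv (inv c \<otimes> g) \<otimes> (inv c \<otimes> g') \<in> U"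
      using B(3) g(1) g'(1) by (simp add: piece_def)
    also have "inv (inv c \<otimes> g) \<otimes> (inv c \<otimes> g') = inv g \<otimes> g'"
      using cG gG g'G by (simp add: inv_mult_group m_assoc) (simp add: m_assoc[symmetric])
    then have "a \<otimes> inv (inv c \<otimes> g) \<otimes> (inv c \<otimes> g') = a \<otimes> inv g \<otimes> g'"
      using aG cG gG g'G by (simp add: m_assoc)
    finally show "pa_app m (a \<otimes> inv g) y \<in> ?f ` U"
      using pa_app_mult(2)[OF g'x] y g'(2) by (metis imageI)
  qed
  then show "z \<in> closure_interior X (?f ` U)"
    using pa_app_mult'(2)[OF gx _ ax] a(2) aG gG by (simp add: m_assoc)
qed

text \<open>Surjectivity, which is where transitivity enters, writes each point of the interior of
  the closure as the image of some \<open>q\<close>; an actual intersection near \<open>q\<close>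
  then moves it into the image of \<open>U\<close>.\<close>

lemma open_map_orbit:
  assumes "polish_group G T" and X: "Hausdorff_space X" and nonmeager: "\<not> meager_in X (topspace X)"
    and x: "x \<in> topspace X" and surj: "(\<lambda>g. pa_app m g x) ` pa_elems m x = topspace X"
    and W: "openin T (pa_elems m x)"
  shows "open_map (subtopology T (pa_elems m x)) X (\<lambda>g. pa_app m g x)"
  unfolding open_map_def
proof (intro allI impI)
  interpret polish_group G T by fact
  let ?f = "\<lambda>g. pa_app m g x" and ?S = "subtopology T (pa_elems m x)"
  fix U assume "openin ?S U"
  then have U: "openin T U" "U \<subseteq> pa_elems m x"
    using W by (simp_all add: openin_open_subtopology)
  have near: "nearly_open_map ?S X ?f"
    using separable nonmeager surj W by (rule nearly_open_orbit_map)
  have compl: "completely_metrizable_space ?S"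
    using completely_metrizable W by (simp add: completely_metrizable_space_openin)
  have "\<exists>V. openin X V \<and> y \<in> V \<and> V \<subseteq> ?f ` U" if y: "y \<in> ?f ` U" for y
  proof -
    obtain a where a: "a \<in> U" "y = ?f a"
      using y by blast
    have aG: "a \<in> carrier G"
      using U(1) a(1) by (rule carrier_openin)
    have "continuous_map (prod_topology T T) T (\<lambda>p. inv (fst p) \<otimes> snd p \<otimes> a)"
      using aG by (intro continuous_map_group_mult continuous_map_group_inv)
        (auto simp: topspace_eq continuous_map_fst continuous_map_snd)
    then obtain N where N: "openin T N" "\<one> \<in> N" "\<And>p q. p \<in> N \<Longrightarrow> q \<in> N \<Longrightarrow> inv p \<otimes> q \<otimes> a \<in> U"
      by (rule openin_diagonal_square[OF _ U(1) one_closed]) (use a aG in auto)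
    \<comment> \<open>The right translate \<open>N b\<close>, cut down to the elements that act on
      \<open>x\<close>.\<close>
    define nbhd where "nbhd b = {g \<in> carrier G. g \<otimes> inv b \<in> N} \<inter> pa_elems m x" for b
    have nbhd_open: "openin ?S (nbhd b)" "b \<in> nbhd b" if "b \<in> pa_elems m x" for b
    proof -
      have "b \<in> carrier G"
        using W that by (rule carrier_openin)
      then show "b \<in> nbhd b"
        using that N(2) by (simp add: nbhd_def)
      have "openin T {g \<in> carrier G. g \<otimes> inv b \<in> N}"
        using N(1) \<open>b \<in> carrier G\<close> by (intro openin_right_translate) auto
      then show "openin ?S (nbhd b)"
        by (simp add: nbhd_def openin_subtopology_Int)
    qed
    have aW: "a \<in> pa_elems m x"
      using a U by blast
    have "closure_interior X (?f ` nbhd a) \<subseteq> ?f ` U"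
    proof
      fix w assume w: "w \<in> closure_interior X (?f ` nbhd a)"
      then have "w \<in> topspace X"
        by (rule subsetD[OF openin_subset[OF openin_closure_interior]])
      then obtain q where q: "q \<in> pa_elems m x" "w = ?f q"
        using surj by blast
      have qG: "q \<in> carrier G"
        using W q(1) by (rule carrier_openin)
      have "w \<in> closure_interior X (?f ` nbhd q)"
        unfolding q(2) using near nbhd_open[OF q(1)] by (rule nearly_open_mapD)
      with w have "nearly_meet X (?f ` nbhd a) (?f ` nbhd q)"
        by (auto simp: nearly_meet_def)
      then have "?f ` nbhd a \<inter> ?f ` nbhd q \<noteq> {}"
        by (rule nearly_meet_imp_meet[OF compl X continuous_map_orbit[OF x] near
              nbhd_open(1)[OF aW] nbhd_open(1)[OF q(1)]])
      then obtain g h where g: "g \<in> nbhd a" and h: "h \<in> nbhd q" and gh: "?f g = ?f h"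
        by auto
      have gG: "g \<in> carrier G" "(g, x) \<in> dom m" "g \<otimes> inv a \<in> N"
        using g by (auto simp: nbhd_def pa_elems_def)
      have hG: "h \<in> carrier G" "(h, x) \<in> dom m" "h \<otimes> inv q \<in> N"
        using h by (auto simp: nbhd_def pa_elems_def)
      \<comment> \<open>This element carries the common point of the two images to \<open>w\<close>.
        Moreover \<open>?k \<otimes> g\<close> equals \<open>inv (h \<otimes> inv q) \<otimes> (g
        \<otimes> inv a) \<otimes> a\<close>, which lies in \<open>U\<close> by the choice of
        \<open>N\<close>.\<close>
      let ?k = "q \<otimes> inv h"
      have kh: "(?k \<otimes> h, x) \<in> dom m"
        using q(1) qG hG(1) by (simp add: m_assoc pa_elems_def)
      have kG: "?k \<in> carrier G"
        using qG hG(1) by simp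
      have "w = pa_app m ?k (?f h)"
        using pa_app_mult'(2)[OF hG(2) kG kh] qG hG(1) q(2) by (simp add: m_assoc)
      also have "\<dots> = ?f (?k \<otimes> g)"
        using pa_app_mult(2)[OF gG(2)] pa_app_mult'(1)[OF hG(2) kG kh] gh by simp
      finally have "w = ?f (?k \<otimes> g)" .
      moreover have "inv (h \<otimes> inv q) \<otimes> (g \<otimes> inv a) \<otimes> a \<in> U"
        using N(3) gG(3) hG(3) by blast
      then have "?k \<otimes> g \<in> U"
        using gG(1) hG(1) qG aG by (simp add: inv_mult_group m_assoc)
      ultimately show "w \<in> ?f ` U"
        by blast
    qed
    moreover have "y \<in> closure_interior X (?f ` nbhd a)"
      unfolding a(2) using near nbhd_open[OF aW] by (rule nearly_open_mapD)
    ultimately show ?thesis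
      using openin_closure_interior by blast
  qed
  then show "openin X (?f ` U)"
    by (subst openin_subopen) blast
qed

end

theorem theorem3p5:
  fixes G :: "('g, 'r) monoid_scheme" and T :: "'g topology"
    and X :: "'x topology" and m :: "'g \<times> 'x \<rightharpoonup> 'x"
  assumes "polish_group G T"
    and "continuous_partial_action G T X m"
    and "transitive_partial_action G (topspace X) m"
    and "Hausdorff_space X"
    and "\<not> meager_in X (topspace X)"
    and "\<exists>y\<in>topspace X. openin T (pa_elems m y)"
  shows "\<forall>x\<in>topspace X. open_map (subtopology T (pa_elems m x)) X (\<lambda>g. pa_app m g x)"
proof
  interpret continuous_partial_action G T X m by fact
  fix x assume x: "x \<in> topspace X"
  have trans: "\<exists>g. (g, x) \<in> dom m \<and> pa_app m g x = y" if "y \<in> topspace X" for y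
    using assms(3) x that unfolding transitive_partial_action_def
    by (metis mem_Collect_eq pa_set_inv)
  obtain y where y: "y \<in> topspace X" "openin T (pa_elems m y)"
    using assms(6) by blast
  obtain h where "(h, x) \<in> dom m" "pa_app m h x = y"
    using trans[OF y(1)] by blast
  with y(2) have W: "openin T (pa_elems m x)"
    by (rule openin_pa_elems_transfer)
  have "(\<lambda>g. pa_app m g x) ` pa_elems m x = topspace X"
    using trans pa_app_in by (force simp: pa_elems_def)
  with assms(1,4,5) x W show "open_map (subtopology T (pa_elems m x)) X (\<lambda>g. pa_app m g x)"
    by (intro open_map_orbit)
qed

end
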